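(* Consider any LCE data structure scheme for strings $T\in\Sigma^n$ consisting of a quantum preprocessing algorithm with cost $\mathcal{T}_{\mathsf{prep}}$ that outputs (with high success probability) a classical data structure $D$, and a quantum query algorithm with cost $\mathcal{T}_{\mathsf{ans}}$ that, given any $i,j\in[n]$ and access to $T$ and $D$, computes $\mathsf{LCE}_T(i,j)$. Then $$(\mathcal{T}_{\mathsf{prep}}+\sqrt n)\cdot(\mathcal{T}_{\mathsf{ans}}+1)\ge\tilde\Omega(n),$$ and this holds even if $\mathcal{T}_{\mathsf{prep}}$ and $\mathcal{T}_{\mathsf{ans}}$ only measure quantum query complexity.
   Context: $\mathsf{LCE}_T(i,j)$ is the length of the longest common prefix of $T[i\,..\,n]$ and $T[j\,..\,n]$. $T$ is accessed via the quantum oracle $|i,b\rangle\mapsto|i,b\oplus T[i]\rangle$. $\tilde\Omega$ hides $\mathrm{polylog}(n)$ factors. *)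

theory Defs
  imports "HOL-Library.Sublist" "HOL-Library.Landau_Symbols" Complex_Main
begin

section \<open>Longest common extensions\<close>

text \<open>Positions are 1-based, so \<open>T[i..n]\<close> is \<open>drop (i - 1) T\<close> and \<open>T[i]\<close> is \<open>T ! (i - 1)\<close>.\<close>

definition LCE :: "'a list \<Rightarrow> nat \<Rightarrow> nat \<Rightarrow> nat" where
  "LCE T i j = length (longest_common_prefix (drop (i - 1) T) (drop (j - 1) T))"

section \<open>Quantum query algorithms\<close>

text \<open>
  A basis state \<open>|i, b, w\<rangle>\<close> consists of a position \<open>i\<close>, an \<open>m\<close>-bit answer register \<open>b\<close>, and
  the content \<open>w\<close> of a finite workspace \<open>W\<close>. The dimension depends on \<open>n\<close>, \<open>m\<close> and \<open>W\<close>, so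
  states and operators are complex-valued functions (coefficient vectors and matrices) on an
  explicit finite basis. In a matrix \<open>U\<close>, the entry \<open>U x y\<close> is the amplitude of \<open>|x\<rangle>\<close> in \<open>U|y\<rangle>\<close>.
\<close>

type_synonym 'w ket = "nat \<times> nat \<times> 'w"

definition query_basis :: "nat \<Rightarrow> nat \<Rightarrow> 'w set \<Rightarrow> 'w ket set" where
  "query_basis n m W = {1..n} \<times> {..<2 ^ m} \<times> W"

definition unitary_on :: "'b set \<Rightarrow> ('b \<Rightarrow> 'b \<Rightarrow> complex) \<Rightarrow> bool" where
  "unitary_on B U \<longleftrightarrow>
     (\<forall>x\<in>B. \<forall>y\<in>B. (\<Sum>z\<in>B. cnj (U z x) * U z y) = (if x = y then 1 else 0))"

definition apply_op :: "'b set \<Rightarrow> ('b \<Rightarrow> 'b \<Rightarrow> complex) \<Rightarrow> ('b \<Rightarrow> complex) \<Rightarrow> 'b \<Rightarrow> complex" where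
  "apply_op B U \<psi> = (\<lambda>x. \<Sum>y\<in>B. U x y * \<psi> y)"

text \<open>The query operator \<open>|i, b\<rangle> \<mapsto> |i, b \<oplus> T[i]\<rangle>\<close>, acting as the identity on the workspace.\<close>

definition query_op :: "nat list \<Rightarrow> 'w ket \<Rightarrow> 'w ket \<Rightarrow> complex" where
  "query_op T x = (\<lambda>(i, b, w).
     if x = (i, xor b (T ! (i - 1)), w) then 1 else 0)"

text \<open>
  An algorithm making \<open>q\<close> queries starts in a fixed basis state, applies
  \<open>U\<^sub>q O\<^sub>T U\<^sub>q\<^sub>-\<^sub>1 O\<^sub>T \<dots> O\<^sub>T U\<^sub>0\<close>, measures in the computational basis, and returns a function of the
  outcome. Intermediate measurements are covered by deferring them to the end.
\<close>

record ('w, 'r) query_alg =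
  workspace :: "'w set"
  start :: "'w ket"
  queries :: nat
  gate :: "nat \<Rightarrow> 'w ket \<Rightarrow> 'w ket \<Rightarrow> complex"
  result :: "'w ket \<Rightarrow> 'r"

definition wf_query_alg :: "nat \<Rightarrow> nat \<Rightarrow> ('w, 'r) query_alg \<Rightarrow> bool" where
  "wf_query_alg n m A \<longleftrightarrow>
     finite (workspace A) \<and>
     start A \<in> query_basis n m (workspace A) \<and>
     (\<forall>t\<le>queries A. unitary_on (query_basis n m (workspace A)) (gate A t))"

fun state_after ::
    "nat \<Rightarrow> nat \<Rightarrow> ('w, 'r) query_alg \<Rightarrow> nat list \<Rightarrow> nat \<Rightarrow> 'w ket \<Rightarrow> complex" where
  "state_after n m A T 0 =
     apply_op (query_basis n m (workspace A)) (gate A 0) (\<lambda>x. if x = start A then 1 else 0)"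
| "state_after n m A T (Suc t) =
     apply_op (query_basis n m (workspace A)) (gate A (Suc t))
       (apply_op (query_basis n m (workspace A)) (query_op T) (state_after n m A T t))"

definition output_prob ::
    "nat \<Rightarrow> nat \<Rightarrow> ('w, 'r) query_alg \<Rightarrow> nat list \<Rightarrow> ('r \<Rightarrow> bool) \<Rightarrow> real" where
  "output_prob n m A T P =
     (\<Sum>x \<in> {x \<in> query_basis n m (workspace A). P (result A x)}.
        (cmod (state_after n m A T (queries A) x))\<^sup>2)"

section \<open>LCE data structure schemes\<close>

text \<open>
  The query algorithm may depend arbitrarily on the classical data \<open>i\<close>, \<open>j\<close> and \<open>D\<close>, so access to
  \<open>D\<close> is unrestricted and free; only \<open>T\<close> is accessed through queries.
\<close>

definition valid_structure ::
    "nat \<Rightarrow> nat \<Rightarrow> (nat \<Rightarrow> nat \<Rightarrow> 'd \<Rightarrow> ('w, nat) query_alg) \<Rightarrow> nat list \<Rightarrow> 'd \<Rightarrow> bool" where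
  "valid_structure n m ans T D \<longleftrightarrow>
     (\<forall>i\<in>{1..n}. \<forall>j\<in>{1..n}. output_prob n m (ans i j D) T (\<lambda>r. r = LCE T i j) \<ge> 2 / 3)"

text \<open>
  The letters of the alphabet \<open>\<Sigma>\<close> are identified with \<open>m\<close>-bit codes. High success probability
  of the preprocessing is only required to mean probability at least \<open>2 / 3\<close>.
\<close>

definition LCE_scheme ::
    "nat \<Rightarrow> nat \<Rightarrow> nat set \<Rightarrow> ('v, 'd) query_alg \<Rightarrow>
     (nat \<Rightarrow> nat \<Rightarrow> 'd \<Rightarrow> ('w, nat) query_alg) \<Rightarrow> bool" where
  "LCE_scheme n m \<Sigma> prep ans \<longleftrightarrow>
     wf_query_alg n m prep \<and>
     (\<forall>i\<in>{1..n}. \<forall>j\<in>{1..n}. \<forall>D. wf_query_alg n m (ans i j D)) \<and>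
     (\<forall>T. length T = n \<and> set T \<subseteq> \<Sigma> \<longrightarrow>
        output_prob n m prep T (valid_structure n m ans T) \<ge> 2 / 3)"

text \<open>\<open>f\<close> is bounded below by \<open>g\<close> up to constant and polylogarithmic factors.\<close>

definition soft_Omega :: "(nat \<Rightarrow> real) \<Rightarrow> (nat \<Rightarrow> real) set" where
  "soft_Omega g = {f. \<exists>k. f \<in> \<Omega>(\<lambda>n. g n / ln (real n) ^ k)}"

end

theory Submission
  imports Defs
begin

text \<open>
  Take \<open>T = a\<^sup>h S\<close> with \<open>S \<in> {a, b}\<^sup>M\<close> and \<open>h \<ge> M\<close>, and identify \<open>S\<close> with the set \<open>x\<close> of positions
  of \<open>b\<close>. The value \<open>LCE T 1 (h + g + 1)\<close> then locates the first element of \<open>x\<close> from \<open>g\<close> on.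
  If one structure \<open>D\<close> is valid for \<open>x\<close> and for \<open>x \<union> {z}\<close>, then the query at the start of the gap
  of \<open>x\<close> containing \<open>z\<close> distinguishes the two strings. The adversary method allows only
  \<open>O(q\<^sup>2)\<close> such \<open>z\<close> per gap, where \<open>q\<close> is the query cost. Hence, for sets of size \<open>k\<close> with
  \<open>(k + 1) q\<^sup>2\<close> much smaller than \<open>M\<close>, almost all neighbours \<open>x \<union> {z}\<close> of \<open>x\<close> have essentially
  disjoint sets of valid structures. The preprocessing therefore distinguishes most neighbouring pairs,
  and the adversary method forces it to make \<open>\<Omega>(sqrt (M k))\<close> queries. Choosing
  \<open>k\<close> of order \<open>M / (q + 1)\<^sup>2\<close> gives the trade-off, and if this is below 1, then \<open>q\<close> is already of
  order \<open>sqrt n\<close>. No logarithmic factor is lost.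
\<close>

section \<open>The adversary method\<close>

definition inner_on :: "'b set \<Rightarrow> ('b \<Rightarrow> complex) \<Rightarrow> ('b \<Rightarrow> complex) \<Rightarrow> complex" where
  "inner_on B \<phi> \<psi> = (\<Sum>x\<in>B. cnj (\<phi> x) * \<psi> x)"

definition mass_on :: "'b set \<Rightarrow> ('b \<Rightarrow> complex) \<Rightarrow> real" where
  "mass_on B \<psi> = (\<Sum>x\<in>B. (cmod (\<psi> x))\<^sup>2)"

lemma mass_on_nonneg: "0 \<le> mass_on B \<psi>"
  by (simp add: mass_on_def sum_nonneg)

lemma mass_on_mono: "finite B \<Longrightarrow> A \<subseteq> B \<Longrightarrow> mass_on A \<psi> \<le> mass_on B \<psi>"
  unfolding mass_on_def by (rule sum_mono2) auto

lemma inner_on_self: "inner_on B \<psi> \<psi> = of_real (mass_on B \<psi>)"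
  unfolding inner_on_def mass_on_def
  by (simp add: complex_norm_square mult.commute del: of_real_power)

lemma inner_on_cong:
  "(\<And>x. x \<in> B \<Longrightarrow> \<phi> x = \<phi>' x) \<Longrightarrow> (\<And>x. x \<in> B \<Longrightarrow> \<psi> x = \<psi>' x)
     \<Longrightarrow> inner_on B \<phi> \<psi> = inner_on B \<phi>' \<psi>'"
  by (simp add: inner_on_def)

text \<open>AM-GM from expanding a square. The free weight \<open>s\<close> later balances the two
  sides of an adversary relation that have different sizes.\<close>

lemma cmod_mult_weighted:
  assumes "s > (0::real)"
  shows "cmod a * cmod b \<le> (s * (cmod a)\<^sup>2 + (cmod b)\<^sup>2 / s) / 2"
proof -
  have "0 \<le> (s * cmod a - cmod b)\<^sup>2 / s" using assms by simp
  also have "\<dots> = s * (cmod a)\<^sup>2 + (cmod b)\<^sup>2 / s - 2 * (cmod a * cmod b)"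
    using assms by (simp add: field_simps power2_eq_square)
  finally show ?thesis by simp
qed

lemma cmod_inner_on_weighted:
  assumes "s > (0::real)"
  shows "cmod (inner_on B \<phi> \<psi>) \<le> (s * mass_on B \<phi> + mass_on B \<psi> / s) / 2"
proof -
  have "cmod (inner_on B \<phi> \<psi>) \<le> (\<Sum>x\<in>B. cmod (\<phi> x) * cmod (\<psi> x))"
    unfolding inner_on_def by (rule sum_norm_le) (simp add: norm_mult)
  also have "\<dots> \<le> (\<Sum>x\<in>B. (s * (cmod (\<phi> x))\<^sup>2 + (cmod (\<psi> x))\<^sup>2 / s) / 2)"
    by (intro sum_mono cmod_mult_weighted assms)
  also have "\<dots> = (s * mass_on B \<phi> + mass_on B \<psi> / s) / 2"
    by (simp add: mass_on_def sum_distrib_left sum.distrib sum_divide_distrib add_divide_distrib)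
  finally show ?thesis .
qed

text \<open>By \<open>U* U = I\<close>, gates that do not depend on the input cannot change the
  overlap of two runs; only queries can.\<close>

lemma inner_on_apply_op:
  assumes "finite B" "unitary_on B U"
  shows "inner_on B (apply_op B U \<phi>) (apply_op B U \<psi>) = inner_on B \<phi> \<psi>"
proof -
  have "inner_on B (apply_op B U \<phi>) (apply_op B U \<psi>)
      = (\<Sum>z\<in>B. \<Sum>x\<in>B. \<Sum>y\<in>B. (cnj (U z x) * U z y) * (cnj (\<phi> x) * \<psi> y))"
    unfolding inner_on_def apply_op_def cnj_sum sum_product
    by (intro sum.cong refl) (simp add: mult_ac)
  also have "\<dots> = (\<Sum>x\<in>B. \<Sum>y\<in>B. \<Sum>z\<in>B. (cnj (U z x) * U z y) * (cnj (\<phi> x) * \<psi> y))"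
    by (subst sum.swap, rule sum.cong[OF refl], rule sum.swap)
  also have "\<dots> = (\<Sum>x\<in>B. \<Sum>y\<in>B. (if x = y then 1 else 0) * (cnj (\<phi> x) * \<psi> y))"
    using assms(2) unfolding unitary_on_def
    by (intro sum.cong refl) (simp add: sum_distrib_right[symmetric])
  also have "\<dots> = (\<Sum>x\<in>B. \<Sum>y\<in>B. if x = y then cnj (\<phi> x) * \<psi> y else 0)"
    by (intro sum.cong refl) simp
  also have "\<dots> = inner_on B \<phi> \<psi>"
    using assms(1) by (simp add: inner_on_def)
  finally show ?thesis .
qed

section \<open>The effect of one query on an overlap\<close>

definition flip :: "nat list \<Rightarrow> 'w ket \<Rightarrow> 'w ket" where
  "flip T = (\<lambda>(i, b, w). (i, xor b (T ! (i - 1)), w))"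

text \<open>The kets about to query position \<open>i\<close>. The oracle permutes each fibre, so
  overlaps and masses split by queried position.\<close>

definition fibre :: "nat \<Rightarrow> 'w set \<Rightarrow> nat \<Rightarrow> 'w ket set" where
  "fibre m W i = {i} \<times> {..<2 ^ m} \<times> W"

lemma flip_flip [simp]: "flip T (flip T x) = x"
  by (cases x) (simp add: flip_def xor.assoc)

lemma xor_less_exp:
  fixes a b :: nat
  assumes "a < 2 ^ m" "b < 2 ^ m"
  shows "xor a b < 2 ^ m"
  using assms by (metis take_bit_nat_eq_self_iff take_bit_xor)

lemma flip_fibre:
  assumes "T ! (i - 1) < 2 ^ m" "x \<in> fibre m W i"
  shows "flip T x \<in> fibre m W i"
  using assms by (auto simp: flip_def fibre_def intro!: xor_less_exp)

lemma bij_betw_flip_fibre: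
  assumes "T ! (i - 1) < 2 ^ m"
  shows "bij_betw (flip T) (fibre m W i) (fibre m W i)"
  by (rule bij_betw_byWitness[where f' = "flip T"]) (use flip_fibre[where T = T, OF assms] in auto)

lemma sum_query_basis:
  "(\<Sum>x\<in>query_basis n m W. f x) = (\<Sum>i\<in>{1..n}. \<Sum>x\<in>fibre m W i. f x)"
proof -
  have "(\<Sum>x\<in>fibre m W i. f x) = (\<Sum>y\<in>{..<2 ^ m} \<times> W. f (i, y))" for i
    unfolding fibre_def by (simp add: sum.cartesian_product')
  then show ?thesis
    unfolding query_basis_def by (simp add: sum.cartesian_product')
qed

text \<open>The oracle is the permutation matrix of the involution \<open>flip T\<close>, so no
  inverse appears on the right. The bound \<open>2 ^ m\<close> on the letters keeps
  \<open>flip T x\<close> inside the basis.\<close>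

lemma apply_query_op:
  assumes "finite W" "\<And>i. i \<in> {1..n} \<Longrightarrow> T ! (i - 1) < 2 ^ m" "x \<in> query_basis n m W"
  shows "apply_op (query_basis n m W) (query_op T) \<psi> x = \<psi> (flip T x)"
proof -
  have fin: "finite (query_basis n m W)" using assms(1) by (simp add: query_basis_def)
  obtain i where i: "i \<in> {1..n}" "x \<in> fibre m W i"
    using assms(3) by (auto simp: query_basis_def fibre_def)
  then have "flip T x \<in> query_basis n m W"
    using flip_fibre[OF assms(2)[OF i(1)] i(2)] by (auto simp: query_basis_def fibre_def)
  moreover have "query_op T x y = (if y = flip T x then 1 else 0)" for y
  proof -
    have "query_op T x y = (if x = flip T y then 1 else 0)"
      by (cases y) (simp add: query_op_def flip_def)
    moreover have "x = flip T y \<longleftrightarrow> y = flip T x" by (metis flip_flip)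
    ultimately show ?thesis by simp
  qed
  ultimately show ?thesis
    using fin by (simp add: apply_op_def if_distrib[where f = "\<lambda>c. c * _"] cong: if_cong)
qed

lemma inner_on_flip:
  assumes "T ! (i - 1) < 2 ^ m"
  shows "inner_on (fibre m W i) (\<phi> \<circ> flip T) (\<psi> \<circ> flip T) = inner_on (fibre m W i) \<phi> \<psi>"
  unfolding inner_on_def
  using sum.reindex_bij_betw[OF bij_betw_flip_fibre[where T = T, OF assms], of "\<lambda>x. cnj (\<phi> x) * \<psi> x"] by simp

lemma mass_on_flip:
  assumes "T ! (i - 1) < 2 ^ m"
  shows "mass_on (fibre m W i) (\<psi> \<circ> flip T) = mass_on (fibre m W i) \<psi>"
  unfolding mass_on_def
  using sum.reindex_bij_betw[OF bij_betw_flip_fibre[where T = T, OF assms], of "\<lambda>x. (cmod (\<psi> x))\<^sup>2"] by simp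

text \<open>On every fibre but that of \<open>i\<close> both oracles are the same permutation and
  preserve the inner product. On the fibre of \<open>i\<close>, the old and the new inner product
  are each bounded by weighted AM-GM, and the two halves add up.\<close>

lemma inner_on_query:
  fixes S T :: "nat list" and n m :: nat and W :: "'w set" and s :: real
  defines "B \<equiv> query_basis n m W"
  assumes W: "finite W" and s: "s > 0" and i: "i \<in> {1..n}"
    and S: "\<And>j. j \<in> {1..n} \<Longrightarrow> S ! (j - 1) < 2 ^ m"
    and T: "\<And>j. j \<in> {1..n} \<Longrightarrow> T ! (j - 1) < 2 ^ m"
    and agree: "\<And>j. j \<in> {1..n} \<Longrightarrow> j \<noteq> i \<Longrightarrow> S ! (j - 1) = T ! (j - 1)"
  shows "cmod (inner_on B (apply_op B (query_op S) \<phi>) (apply_op B (query_op T) \<psi>) - inner_on B \<phi> \<psi>)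
           \<le> s * mass_on (fibre m W i) \<phi> + mass_on (fibre m W i) \<psi> / s"
proof -
  let ?d = "\<lambda>j. inner_on (fibre m W j) (\<phi> \<circ> flip S) (\<psi> \<circ> flip T) - inner_on (fibre m W j) \<phi> \<psi>"
  have split: "inner_on B \<alpha> \<beta> = (\<Sum>j\<in>{1..n}. inner_on (fibre m W j) \<alpha> \<beta>)" for \<alpha> \<beta> :: "'w ket \<Rightarrow> complex"
    unfolding inner_on_def B_def by (rule sum_query_basis)
  have "inner_on B (apply_op B (query_op S) \<phi>) (apply_op B (query_op T) \<psi>)
      = inner_on B (\<phi> \<circ> flip S) (\<psi> \<circ> flip T)"
    unfolding B_def using apply_query_op[OF W S] apply_query_op[OF W T]
    by (intro inner_on_cong) (simp_all)
  then have "inner_on B (apply_op B (query_op S) \<phi>) (apply_op B (query_op T) \<psi>) - inner_on B \<phi> \<psi>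
      = (\<Sum>j\<in>{1..n}. ?d j)"
    by (simp add: split sum_subtractf)
  also have "\<dots> = (\<Sum>j\<in>{i}. ?d j)"
  proof (rule sum.mono_neutral_right)
    show "\<forall>j\<in>{1..n} - {i}. ?d j = 0"
    proof
      fix j assume j: "j \<in> {1..n} - {i}"
      then have eq: "S ! (j - 1) = T ! (j - 1)" using agree by simp
      have "inner_on (fibre m W j) (\<phi> \<circ> flip S) (\<psi> \<circ> flip T)
          = inner_on (fibre m W j) (\<phi> \<circ> flip T) (\<psi> \<circ> flip T)"
        by (rule inner_on_cong) (use eq in \<open>auto simp: flip_def fibre_def\<close>)
      then show "?d j = 0" using inner_on_flip[of T j m W \<phi> \<psi>] T[of j] j by simp
    qed
  qed (use i in auto)
  finally have "cmod (inner_on B (apply_op B (query_op S) \<phi>) (apply_op B (query_op T) \<psi>) - inner_on B \<phi> \<psi>)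
      \<le> cmod (inner_on (fibre m W i) (\<phi> \<circ> flip S) (\<psi> \<circ> flip T)) + cmod (inner_on (fibre m W i) \<phi> \<psi>)"
    by (simp add: norm_triangle_ineq4)
  also have "\<dots> \<le> (s * mass_on (fibre m W i) \<phi> + mass_on (fibre m W i) \<psi> / s) / 2
      + (s * mass_on (fibre m W i) \<phi> + mass_on (fibre m W i) \<psi> / s) / 2"
    using cmod_inner_on_weighted[OF s, of "fibre m W i" "\<phi> \<circ> flip S" "\<psi> \<circ> flip T"]
      cmod_inner_on_weighted[OF s, of "fibre m W i" \<phi> \<psi>]
    by (simp add: mass_on_flip[where T = S, OF S[OF i]] mass_on_flip[where T = T, OF T[OF i]])
  finally show ?thesis by simp
qed

section \<open>The progress measure over a whole run\<close>

lemma inner_on_ket: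
  assumes "finite B" "a \<in> B"
  shows "inner_on B (\<lambda>x. if x = a then 1 else 0) (\<lambda>x. if x = a then 1 else 0) = 1"
proof -
  have "inner_on B (\<lambda>x. if x = a then 1 else 0) (\<lambda>x. if x = a then 1 else 0)
      = (\<Sum>x\<in>B. if x = a then 1 else 0)"
    unfolding inner_on_def by (intro sum.cong refl) simp
  then show ?thesis using assms by simp
qed

lemma mass_state_after:
  fixes A :: "('w, 'r) query_alg"
  assumes wf: "wf_query_alg n m A" and T: "\<And>j. j \<in> {1..n} \<Longrightarrow> T ! (j - 1) < 2 ^ m"
    and t: "t \<le> queries A"
  shows "mass_on (query_basis n m (workspace A)) (state_after n m A T t) = 1"
proof -
  define B where "B = query_basis n m (workspace A)"
  have W: "finite (workspace A)" and start: "start A \<in> B"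
    and U: "\<And>t. t \<le> queries A \<Longrightarrow> unitary_on B (gate A t)"
    using wf by (auto simp: wf_query_alg_def B_def)
  have B: "finite B" using W by (simp add: B_def query_basis_def)
  have "inner_on B (state_after n m A T t) (state_after n m A T t) = 1"
    using t
  proof (induction t)
    case 0
    show ?case
      unfolding state_after.simps B_def[symmetric] inner_on_apply_op[OF B U[OF 0]]
      by (rule inner_on_ket[OF B start])
  next
    case (Suc t)
    let ?\<psi> = "state_after n m A T t"
    have "inner_on B (apply_op B (query_op T) ?\<psi>) (apply_op B (query_op T) ?\<psi>)
        = inner_on B (?\<psi> \<circ> flip T) (?\<psi> \<circ> flip T)"
      unfolding B_def using apply_query_op[OF W T] by (intro inner_on_cong) simp_all
    also have "\<dots> = (\<Sum>j\<in>{1..n}. inner_on (fibre m (workspace A) j) (?\<psi> \<circ> flip T) (?\<psi> \<circ> flip T))"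
      unfolding inner_on_def B_def by (rule sum_query_basis)
    also have "\<dots> = (\<Sum>j\<in>{1..n}. inner_on (fibre m (workspace A) j) ?\<psi> ?\<psi>)"
      by (intro sum.cong refl inner_on_flip T)
    also have "\<dots> = inner_on B ?\<psi> ?\<psi>"
      unfolding inner_on_def B_def by (rule sum_query_basis[symmetric])
    also have "\<dots> = 1" using Suc by simp
    finally show ?case
      unfolding state_after.simps B_def[symmetric] inner_on_apply_op[OF B U[OF Suc.prems]] .
  qed
  then show ?thesis unfolding inner_on_self B_def by simp
qed

text \<open>The weights \<open>3/2\<close>, \<open>2/3\<close> and \<open>50\<close> are near-optimal in the AM-GM inequality on the parts
  of the basis where \<open>\<phi>\<close> fails, where only \<open>\<psi>\<close> fails, and where both succeed.\<close>

lemma overlap_bound: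
  assumes B: "finite B" and sub: "C \<subseteq> B" "D \<subseteq> B"
    and one: "mass_on B \<phi> = 1" "mass_on B \<psi> = 1"
    and C: "mass_on C \<phi> \<ge> 2 / 3" and D: "mass_on D \<psi> \<ge> 2 / 3"
  shows "Re (inner_on B \<phi> \<psi>) \<le> 24 / 25 + 25 * mass_on (C \<inter> D) \<phi>"
proof -
  let ?E = "B - C" and ?F = "C - D" and ?G = "C \<inter> D"
  have fin: "finite C" "finite D" using B sub finite_subset by auto
  have split: "sum f B = sum f ?E + sum f ?F + sum f ?G" for f :: "_ \<Rightarrow> 'z::comm_monoid_add"
  proof -
    have "sum f B = sum f ?E + sum f C" using B sub by (metis sum.subset_diff)
    also have "sum f C = sum f ?F + sum f ?G"
      using fin by (metis Diff_Diff_Int Diff_subset add.commute sum.subset_diff)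
    finally show ?thesis by (simp add: add.assoc)
  qed
  have m: "mass_on ?E f + mass_on ?F f + mass_on ?G f = mass_on B f" for f
    unfolding mass_on_def by (rule split[symmetric])
  have EC: "mass_on ?E \<phi> + mass_on C \<phi> = 1"
    using B sub(1) one(1) unfolding mass_on_def by (metis sum.subset_diff)
  have "mass_on (B - D) \<psi> + mass_on D \<psi> = 1"
    using B sub(2) one(2) unfolding mass_on_def by (metis sum.subset_diff)
  moreover have "mass_on ?F \<psi> \<le> mass_on (B - D) \<psi>" using B sub by (intro mass_on_mono) auto
  ultimately have F: "mass_on ?F \<psi> \<le> 1 / 3" using D by simp
  have "Re (inner_on B \<phi> \<psi>) \<le> cmod (inner_on ?E \<phi> \<psi> + inner_on ?F \<phi> \<psi> + inner_on ?G \<phi> \<psi>)"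
    unfolding inner_on_def split[symmetric] by (rule complex_Re_le_cmod)
  also have "\<dots> \<le> cmod (inner_on ?E \<phi> \<psi>) + cmod (inner_on ?F \<phi> \<psi>) + cmod (inner_on ?G \<phi> \<psi>)"
    by (meson add_mono norm_triangle_ineq order_trans order_refl)
  also have "\<dots> \<le> (3 / 2 * mass_on ?E \<phi> + mass_on ?E \<psi> / (3 / 2)) / 2
      + (2 / 3 * mass_on ?F \<phi> + mass_on ?F \<psi> / (2 / 3)) / 2
      + (50 * mass_on ?G \<phi> + mass_on ?G \<psi> / 50) / 2"
    by (intro add_mono cmod_inner_on_weighted) auto
  \<comment> \<open>Since \<open>?E\<close> has \<open>\<phi>\<close>-mass and \<open>?F\<close> has
    \<open>\<psi>\<close>-mass at most 1/3, the terms outside the one in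
    \<open>mass_on ?G \<phi>\<close> are at most \<open>2 * (1/4 + 2/9) = 17/18\<close>, which is
    below \<open>24/25\<close>.\<close>
  finally show ?thesis
    using EC C F m[of \<phi>] m[of \<psi>] one mass_on_nonneg[of ?G \<phi>] mass_on_nonneg[of ?G \<psi>] mass_on_nonneg[of ?F \<phi>] mass_on_nonneg[of ?E \<psi>]
    by (simp add: field_simps)
qed

text \<open>Each distinct string has total query mass 1, spread over the positions. Injectivity
  charges every pair of string and position at most once, so each string contributes at most
  1.\<close>

lemma sum_mass_fibre_le:
  fixes A :: "('w, 'r) query_alg"
  assumes wf: "wf_query_alg n m A" and t: "t \<le> queries A" and I: "finite I"
    and inj: "inj_on (\<lambda>p. (u p, pos p)) I" and pos: "pos ` I \<subseteq> {1..n}"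
    and u: "\<And>p j. p \<in> I \<Longrightarrow> j \<in> {1..n} \<Longrightarrow> u p ! (j - 1) < 2 ^ m"
  shows "(\<Sum>p\<in>I. mass_on (fibre m (workspace A) (pos p)) (state_after n m A (u p) t)) \<le> card (u ` I)"
proof -
  let ?f = "\<lambda>(T, i). mass_on (fibre m (workspace A) i) (state_after n m A T t)"
  have "(\<Sum>p\<in>I. mass_on (fibre m (workspace A) (pos p)) (state_after n m A (u p) t))
      = sum ?f ((\<lambda>p. (u p, pos p)) ` I)"
    by (simp add: sum.reindex[OF inj])
  also have "\<dots> \<le> sum ?f (u ` I \<times> {1..n})"
    by (rule sum_mono2) (use I pos in \<open>auto simp: mass_on_nonneg\<close>)
  also have "\<dots> = (\<Sum>T\<in>u ` I. \<Sum>i\<in>{1..n}. ?f (T, i))"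
    by (simp add: sum.cartesian_product)
  also have "\<dots> = (\<Sum>T\<in>u ` I. mass_on (query_basis n m (workspace A)) (state_after n m A T t))"
    by (simp add: mass_on_def sum_query_basis)
  also have "\<dots> = (\<Sum>T\<in>u ` I. 1)"
    using u by (intro sum.cong refl mass_state_after[OF wf _ t]) auto
  finally show ?thesis by simp
qed

text \<open>The total overlap over all related pairs is the progress measure: it starts at
  \<open>card I\<close>, gates preserve it, and each query lowers it by at most the query masses at
  the differing positions.\<close>

lemma sum_inner_state_after:
  fixes A :: "('w, 'r) query_alg" and u v :: "'p \<Rightarrow> nat list"
    and n m :: nat and s :: real
  defines "B \<equiv> query_basis n m (workspace A)"
  assumes wf: "wf_query_alg n m A" and I: "finite I" and s: "s > 0"
    and pos: "pos ` I \<subseteq> {1..n}"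
    and inj: "inj_on (\<lambda>p. (u p, pos p)) I" "inj_on (\<lambda>p. (v p, pos p)) I"
    and u: "\<And>p j. p \<in> I \<Longrightarrow> j \<in> {1..n} \<Longrightarrow> u p ! (j - 1) < 2 ^ m"
    and v: "\<And>p j. p \<in> I \<Longrightarrow> j \<in> {1..n} \<Longrightarrow> v p ! (j - 1) < 2 ^ m"
    and agree: "\<And>p j. p \<in> I \<Longrightarrow> j \<in> {1..n} \<Longrightarrow> j \<noteq> pos p \<Longrightarrow> u p ! (j - 1) = v p ! (j - 1)"
    and t: "t \<le> queries A"
  shows "real (card I) - real t * (s * card (u ` I) + card (v ` I) / s)
       \<le> (\<Sum>p\<in>I. Re (inner_on B (state_after n m A (u p) t) (state_after n m A (v p) t)))"
  using t
proof (induction t)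
  have W: "finite (workspace A)" and start: "start A \<in> B"
    and U: "\<And>t. t \<le> queries A \<Longrightarrow> unitary_on B (gate A t)"
    using wf by (auto simp: wf_query_alg_def B_def)
  have B: "finite B" using W by (simp add: B_def query_basis_def)
  {
    case 0
    have "inner_on B (state_after n m A (u p) 0) (state_after n m A (v p) 0) = 1" for p
      unfolding state_after.simps B_def[symmetric] inner_on_apply_op[OF B U[OF 0]]
      by (rule inner_on_ket[OF B start])
    then show ?case by simp
  next
    case (Suc t)
    let ?\<phi> = "\<lambda>p. state_after n m A (u p) t" and ?\<psi> = "\<lambda>p. state_after n m A (v p) t"
    let ?F = "\<lambda>p. fibre m (workspace A) (pos p)"
    have step: "Re (inner_on B (?\<phi> p) (?\<psi> p)) - (s * mass_on (?F p) (?\<phi> p) + mass_on (?F p) (?\<psi> p) / s)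
        \<le> Re (inner_on B (state_after n m A (u p) (Suc t)) (state_after n m A (v p) (Suc t)))"
      if p: "p \<in> I" for p
    proof -
      have "inner_on B (state_after n m A (u p) (Suc t)) (state_after n m A (v p) (Suc t))
          = inner_on B (apply_op B (query_op (u p)) (?\<phi> p)) (apply_op B (query_op (v p)) (?\<psi> p))"
        unfolding state_after.simps B_def[symmetric] inner_on_apply_op[OF B U[OF Suc.prems]] ..
      moreover have "cmod (inner_on B (apply_op B (query_op (u p)) (?\<phi> p)) (apply_op B (query_op (v p)) (?\<psi> p))
          - inner_on B (?\<phi> p) (?\<psi> p)) \<le> s * mass_on (?F p) (?\<phi> p) + mass_on (?F p) (?\<psi> p) / s"
        unfolding B_def using pos p by (intro inner_on_query W s u v agree) auto
      ultimately show ?thesis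
        using abs_Re_le_cmod[of "inner_on B (apply_op B (query_op (u p)) (?\<phi> p)) (apply_op B (query_op (v p)) (?\<psi> p))
          - inner_on B (?\<phi> p) (?\<psi> p)"]
        by (simp add: abs_le_iff del: state_after.simps)
    qed
    have t: "t \<le> queries A" using Suc.prems by simp
    have "(\<Sum>p\<in>I. s * mass_on (?F p) (?\<phi> p) + mass_on (?F p) (?\<psi> p) / s)
        \<le> s * card (u ` I) + card (v ` I) / s"
      using sum_mass_fibre_le[OF wf t I inj(1) pos u] sum_mass_fibre_le[OF wf t I inj(2) pos v] s
      by (simp add: sum.distrib sum_distrib_left[symmetric] sum_divide_distrib[symmetric]
          add_mono divide_right_mono)
    moreover have arith: "x - real (Suc t) * K \<le> y - z" if "z \<le> K" "x - real t * K \<le> y" for x y z K :: real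
      using that by (simp add: algebra_simps)
    ultimately have "real (card I) - real (Suc t) * (s * card (u ` I) + card (v ` I) / s)
        \<le> (\<Sum>p\<in>I. Re (inner_on B (?\<phi> p) (?\<psi> p)))
          - (\<Sum>p\<in>I. s * mass_on (?F p) (?\<phi> p) + mass_on (?F p) (?\<psi> p) / s)"
      using Suc.IH[OF t] by (intro arith)
    also have "\<dots> \<le> (\<Sum>p\<in>I. Re (inner_on B (state_after n m A (u p) (Suc t)) (state_after n m A (v p) (Suc t))))"
      unfolding sum_subtractf[symmetric] by (rule sum_mono[OF step])
    finally show ?case .
  }
qed

text \<open>Compares the overlap remaining after the last query with \<open>overlap_bound\<close>;
  \<open>1 / 25\<close> is \<open>1 - 24 / 25\<close>. Correctness is a predicate because several
  outputs, such as different structures, may be correct for one string. The last sum charges outputs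
  on \<open>u p\<close> that are correct for \<open>v p\<close> too.\<close>

lemma adversary_bound:
  fixes A :: "('w, 'r) query_alg" and u v :: "'p \<Rightarrow> nat list" and s :: real
  assumes wf: "wf_query_alg n m A" and I: "finite I" and s: "s > 0"
    and pos: "pos ` I \<subseteq> {1..n}"
    and inj: "inj_on (\<lambda>p. (u p, pos p)) I" "inj_on (\<lambda>p. (v p, pos p)) I"
    and u: "\<And>p j. p \<in> I \<Longrightarrow> j \<in> {1..n} \<Longrightarrow> u p ! (j - 1) < 2 ^ m"
    and v: "\<And>p j. p \<in> I \<Longrightarrow> j \<in> {1..n} \<Longrightarrow> v p ! (j - 1) < 2 ^ m"
    and agree: "\<And>p j. p \<in> I \<Longrightarrow> j \<in> {1..n} \<Longrightarrow> j \<noteq> pos p \<Longrightarrow> u p ! (j - 1) = v p ! (j - 1)"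
    and ok: "\<And>p. p \<in> I \<Longrightarrow> output_prob n m A (u p) (P (u p)) \<ge> 2 / 3"
      "\<And>p. p \<in> I \<Longrightarrow> output_prob n m A (v p) (P (v p)) \<ge> 2 / 3"
  shows "real (card I) / 25 \<le> real (queries A) * (s * card (u ` I) + card (v ` I) / s)
           + 25 * (\<Sum>p\<in>I. output_prob n m A (u p) (\<lambda>r. P (u p) r \<and> P (v p) r))"
proof -
  define B where "B = query_basis n m (workspace A)"
  let ?q = "queries A"
  have B: "finite B" using wf by (simp add: wf_query_alg_def B_def query_basis_def)
  have out: "output_prob n m A T Q = mass_on {x \<in> B. Q (result A x)} (state_after n m A T ?q)" for T Q
    by (simp add: output_prob_def mass_on_def B_def)
  have "Re (inner_on B (state_after n m A (u p) ?q) (state_after n m A (v p) ?q))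
      \<le> 24 / 25 + 25 * output_prob n m A (u p) (\<lambda>r. P (u p) r \<and> P (v p) r)" if p: "p \<in> I" for p
  proof -
    let ?C = "\<lambda>T. {x \<in> B. P T (result A x)}"
    have "?C (u p) \<inter> ?C (v p) = {x \<in> B. P (u p) (result A x) \<and> P (v p) (result A x)}" by auto
    then show ?thesis
      using overlap_bound[OF B, of "?C (u p)" "?C (v p)" "state_after n m A (u p) ?q" "state_after n m A (v p) ?q"]
        mass_state_after[OF wf u[OF p] order_refl, folded B_def]
        mass_state_after[OF wf v[OF p] order_refl, folded B_def] ok[OF p, unfolded out]
      unfolding out by auto
  qed
  then have "(\<Sum>p\<in>I. Re (inner_on B (state_after n m A (u p) ?q) (state_after n m A (v p) ?q)))
      \<le> (\<Sum>p\<in>I. 24 / 25 + 25 * output_prob n m A (u p) (\<lambda>r. P (u p) r \<and> P (v p) r))"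
    by (rule sum_mono)
  moreover have "real (card I) - real ?q * (s * card (u ` I) + card (v ` I) / s)
      \<le> (\<Sum>p\<in>I. Re (inner_on B (state_after n m A (u p) ?q) (state_after n m A (v p) ?q)))"
    unfolding B_def by (rule sum_inner_state_after[OF wf I s pos inj u v agree order_refl])
  ultimately show ?thesis
    by (simp add: sum.distrib sum_distrib_left[symmetric])
qed

section \<open>Longest common extensions of marked strings\<close>

lemma LCE_le:
  assumes "i - 1 + d < length T" "j - 1 + d < length T" "T ! (i - 1 + d) \<noteq> T ! (j - 1 + d)"
  shows "LCE T i j \<le> d"
proof (rule ccontr)
  let ?xs = "drop (i - 1) T" and ?ys = "drop (j - 1) T"
  let ?p = "longest_common_prefix ?xs ?ys"
  assume "\<not> LCE T i j \<le> d"
  then have d: "d < length ?p" by (simp add: LCE_def)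
  have "prefix ?p ?xs" "prefix ?p ?ys"
    by (rule longest_common_prefix_prefix1, rule longest_common_prefix_prefix2)
  with d have "?xs ! d = ?ys ! d" by (metis nth_append prefix_def)
  then show False using assms by simp
qed

lemma LCE_ge:
  assumes "i - 1 + d \<le> length T" "j - 1 + d \<le> length T"
    and eq: "\<And>e. e < d \<Longrightarrow> T ! (i - 1 + e) = T ! (j - 1 + e)"
  shows "d \<le> LCE T i j"
proof -
  let ?xs = "drop (i - 1) T" and ?ys = "drop (j - 1) T"
  have "take d ?xs = take d ?ys"
    by (rule nth_equalityI) (use assms in auto)
  then have "prefix (take d ?xs) (longest_common_prefix ?xs ?ys)"
    by (metis longest_common_prefix_max_prefix take_is_prefix)
  then show ?thesis
    using assms(1) by (auto simp: LCE_def dest: prefix_length_le)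
qed

text \<open>Elements of \<open>x\<close> are 0-based offsets into the second part, so
  \<open>p\<close> sits at the 1-based position \<open>h + p + 1\<close>.\<close>

definition marked :: "nat \<Rightarrow> nat \<Rightarrow> nat \<Rightarrow> nat \<Rightarrow> nat set \<Rightarrow> nat list" where
  "marked a b h M x = replicate h a @ map (\<lambda>p. if p \<in> x then b else a) [0..<M]"

lemma length_marked [simp]: "length (marked a b h M x) = h + M"
  by (simp add: marked_def)

lemma nth_marked:
  "i < h + M \<Longrightarrow> marked a b h M x ! i = (if h \<le> i \<and> i - h \<in> x then b else a)"
  by (auto simp: marked_def nth_append)

lemma set_marked: "set (marked a b h M x) \<subseteq> {a, b}"
  by (auto simp: marked_def)

lemma marked_inject:
  assumes "a \<noteq> b" "x \<subseteq> {..<M}" "y \<subseteq> {..<M}" "marked a b h M x = marked a b h M y"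
  shows "x = y"
proof -
  have "p \<in> x \<longleftrightarrow> p \<in> y" if "p < M" for p
    using that assms(1) arg_cong[OF assms(4), of "\<lambda>T. T ! (h + p)"]
    by (simp add: nth_marked split: if_splits)
  then show ?thesis using assms(2,3) by blast
qed

text \<open>Comparing with the constant prefix scans from offset \<open>g\<close> for the next
  \<open>b\<close>: the scan stops by \<open>z\<close> once \<open>z\<close> is inserted and passes
  \<open>z\<close> otherwise. \<open>M \<le> h\<close> keeps the reference side of this comparison
  inside the prefix.\<close>

lemma LCE_marked_insert:
  assumes "a \<noteq> b" "M \<le> h" "g \<le> z" "z < M" and gap: "x \<inter> {g..z} = {}"
  shows "LCE (marked a b h M (insert z x)) 1 (h + g + 1) < LCE (marked a b h M x) 1 (h + g + 1)"
proof -
  have "LCE (marked a b h M (insert z x)) 1 (h + g + 1) \<le> z - g"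
    by (rule LCE_le) (use assms in \<open>auto simp: nth_marked\<close>)
  moreover have "z - g + 1 \<le> LCE (marked a b h M x) 1 (h + g + 1)"
  proof (rule LCE_ge)
    fix e assume e: "e < z - g + 1"
    then have "g + e \<notin> x" using gap \<open>g \<le> z\<close> by (auto simp: disjoint_iff)
    moreover have "e < h" using e assms(2-4) by simp
    ultimately show "marked a b h M x ! (1 - 1 + e) = marked a b h M x ! (h + g + 1 - 1 + e)"
      using e assms(2-4) by (simp add: nth_marked)
  qed (use assms in auto)
  ultimately show ?thesis by simp
qed

lemma marked_less:
  "a < 2 ^ m \<Longrightarrow> b < 2 ^ m \<Longrightarrow> j \<in> {1..h + M} \<Longrightarrow> marked a b h M x ! (j - 1) < 2 ^ m"
  by (auto simp: nth_marked)

lemma marked_agree: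
  assumes "j \<in> {1..h + M}" "j \<noteq> h + z + 1"
  shows "marked a b h M x ! (j - 1) = marked a b h M (insert z x) ! (j - 1)"
  using assms by (auto simp: nth_marked)

section \<open>The trade-off\<close>

text \<open>A search lower bound: one string \<open>x\<close> against \<open>card Z\<close>
  neighbours, with no common correct answer. The weight \<open>sqrt (card Z)\<close> balances 1
  against \<open>card Z\<close>, giving \<open>card Z / 25 \<le> 2 q sqrt (card Z)\<close> for
  \<open>q\<close> queries, whence \<open>2500 = 50 * 50\<close>.\<close>

lemma card_gap_le:
  fixes A :: "('w, nat) query_alg" and a b h M m :: nat
  defines "correct x g \<equiv> output_prob (h + M) m A (marked a b h M x) (\<lambda>r. r = LCE (marked a b h M x) 1 (h + g + 1)) \<ge> 2 / 3"
  assumes wf: "wf_query_alg (h + M) m A" and ab: "a < 2 ^ m" "b < 2 ^ m" "a \<noteq> b" and M: "M \<le> h"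
    and x: "x \<subseteq> {..<M}" "correct x g"
    and Z: "Z \<subseteq> {g..<M}" "\<And>z. z \<in> Z \<Longrightarrow> x \<inter> {g..z} = {}" "\<And>z. z \<in> Z \<Longrightarrow> correct (insert z x) g"
  shows "real (card Z) \<le> 2500 * (real (queries A))\<^sup>2"
proof (cases "Z = {}")
  case False
  let ?u = "\<lambda>z. marked a b h M x" and ?v = "\<lambda>z. marked a b h M (insert z x)"
  let ?P = "\<lambda>T r. r = LCE T 1 (h + g + 1)"
  define s where "s = sqrt (card Z)"
  have fin: "finite Z" using Z(1) finite_subset by blast
  then have s: "s > 0" "s * s = card Z" using False by (simp_all add: s_def card_gt_0_iff)
  have zero: "output_prob (h + M) m A (?u z) (\<lambda>r. ?P (?u z) r \<and> ?P (?v z) r) = 0" if z: "z \<in> Z" for z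
  proof -
    have "LCE (?v z) 1 (h + g + 1) \<noteq> LCE (?u z) 1 (h + g + 1)"
      using LCE_marked_insert[OF ab(3) M _ _ Z(2)[OF z]] Z(1) z by fastforce
    then have "(\<lambda>r. ?P (?u z) r \<and> ?P (?v z) r) = (\<lambda>r. False)" by auto
    then show ?thesis by (simp only: output_prob_def) simp
  qed
  have "real (card Z) / 25 \<le> real (queries A) * (s * card (?u ` Z) + card (?v ` Z) / s)
      + 25 * (\<Sum>z\<in>Z. output_prob (h + M) m A (?u z) (\<lambda>r. ?P (?u z) r \<and> ?P (?v z) r))"
  proof (rule adversary_bound[OF wf fin s(1), where pos = "\<lambda>z. h + z + 1"])
    show "2 / 3 \<le> output_prob (h + M) m A (?v z) (?P (?v z))" if "z \<in> Z" for z
      using Z(3)[OF that] by (simp add: correct_def)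
    show "2 / 3 \<le> output_prob (h + M) m A (?u z) (?P (?u z))" for z
      using x(2) by (simp add: correct_def)
  qed (use Z(1) ab in \<open>auto simp del: One_nat_def intro!: inj_onI marked_less marked_agree\<close>)
  also have "(\<Sum>z\<in>Z. output_prob (h + M) m A (?u z) (\<lambda>r. ?P (?u z) r \<and> ?P (?v z) r)) = 0"
    using zero by simp
  also have "real (queries A) * (s * card (?u ` Z) + card (?v ` Z) / s) \<le> real (queries A) * (s * 1 + card Z / s)"
    using s(1) False card_image_le[OF fin, of ?v]
    by (intro mult_left_mono add_mono divide_right_mono) (auto simp: image_constant_conv)
  also have "real (card Z) / s = s" using s by (simp add: field_simps)
  finally have "s * s \<le> s * (50 * queries A)" using s(2) by (simp add: algebra_simps)
  then have "s \<le> 50 * queries A" using s(1) by simp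
  then have "s\<^sup>2 \<le> (50 * real (queries A))\<^sup>2" using s(1) by (intro power_mono) auto
  then show ?thesis using s(2) by (simp add: power2_eq_square)
qed simp

text \<open>Gaps of \<open>x\<close> start at 0 or just after an element of \<open>x\<close>, so
  there are at most \<open>card x + 1\<close> starts. Within one gap, a single query tests all
  candidates \<open>z\<close>, and \<open>card_gap_le\<close> applies.\<close>

lemma card_valid_insert_le:
  assumes wf: "\<And>i j. i \<in> {1..h + M} \<Longrightarrow> j \<in> {1..h + M} \<Longrightarrow> wf_query_alg (h + M) m (ans i j D)"
    and cost: "\<And>i j. i \<in> {1..h + M} \<Longrightarrow> j \<in> {1..h + M} \<Longrightarrow> real (queries (ans i j D)) \<le> c"
    and ab: "a < 2 ^ m" "b < 2 ^ m" "a \<noteq> b" and M: "M \<le> h" and x: "x \<subseteq> {..<M}"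
    and valid: "valid_structure (h + M) m ans (marked a b h M x) D"
  shows "real (card {z \<in> {..<M} - x. valid_structure (h + M) m ans (marked a b h M (insert z x)) D})
       \<le> real (card x + 1) * (2500 * c\<^sup>2)"
proof -
  let ?valid = "\<lambda>z. valid_structure (h + M) m ans (marked a b h M (insert z x)) D"
  let ?G = "insert 0 (Suc ` x)"
  let ?Z = "\<lambda>g. {z \<in> {g..<M}. x \<inter> {g..z} = {} \<and> ?valid z}"
  have fin: "finite x" using x finite_subset by blast
  have Z: "real (card (?Z g)) \<le> 2500 * c\<^sup>2" for g
  \<comment> \<open>If \<open>M - 1\<close> is in \<open>x\<close>, then \<open>g = M\<close> is a
    start whose query position exceeds the string, but no \<open>z\<close> remains there.\<close>
  proof (cases "g < M")
    case True
    then have ij: "1 \<in> {1..h + M}" "h + g + 1 \<in> {1..h + M}" by auto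
    have "real (card (?Z g)) \<le> 2500 * (real (queries (ans 1 (h + g + 1) D)))\<^sup>2"
      by (rule card_gap_le[OF wf[OF ij] ab M x])
        (use valid ij in \<open>auto simp: valid_structure_def\<close>)
    also have "\<dots> \<le> 2500 * c\<^sup>2"
      using cost[OF ij] by (intro mult_left_mono power_mono) auto
    finally show ?thesis .
  qed simp
  have "{z \<in> {..<M} - x. ?valid z} \<subseteq> (\<Union>g\<in>?G. ?Z g)"
  proof
    fix z assume z: "z \<in> {z \<in> {..<M} - x. ?valid z}"
    \<comment> \<open>The start of the gap containing \<open>z\<close>; it exists because 0 is a
      candidate.\<close>
    define g where "g = Max {g \<in> ?G. g \<le> z}"
    have fin': "finite {g \<in> ?G. g \<le> z}" using fin by simp
    have "{g \<in> ?G. g \<le> z} \<noteq> {}" by blast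
    from Max_in[OF fin' this] have g: "g \<in> ?G" "g \<le> z" unfolding g_def by simp_all
    have "p \<notin> x" if p: "p \<in> {g..z}" for p
    proof
      assume "p \<in> x"
      moreover then have "p < z" using z p by (cases "p = z") auto
      ultimately have "Suc p \<le> g" unfolding g_def using fin' by (intro Max_ge) auto
      then show False using p by simp
    qed
    then show "z \<in> (\<Union>g\<in>?G. ?Z g)" using g z by (intro UN_I[of g]) auto
  qed
  then have "card {z \<in> {..<M} - x. ?valid z} \<le> card (\<Union>g\<in>?G. ?Z g)"
    using fin by (intro card_mono) auto
  also have "\<dots> \<le> (\<Sum>g\<in>?G. card (?Z g))" using fin by (intro card_UN_le) simp
  finally have "real (card {z \<in> {..<M} - x. ?valid z}) \<le> (\<Sum>g\<in>?G. real (card (?Z g)))"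
    by (simp flip: of_nat_sum)
  also have "\<dots> \<le> real (card ?G) * (2500 * c\<^sup>2)" using Z by (intro sum_bounded_above)
  also have "card ?G = card x + 1" using fin by (simp add: card_image)
  finally show ?thesis by simp
qed

section \<open>The cost of preprocessing\<close>

text \<open>The run on \<open>T\<close> does not depend on \<open>z\<close>. After swapping the
  sums, each outcome is counted at most \<open>N\<close> times with its probability, and the
  probabilities sum to 1.\<close>

lemma sum_output_prob_le:
  assumes wf: "wf_query_alg n m A" and T: "\<And>j. j \<in> {1..n} \<Longrightarrow> T ! (j - 1) < 2 ^ m"
    and Z: "finite Z" and N: "\<And>r. P r \<Longrightarrow> real (card {z \<in> Z. Q z r}) \<le> N" "0 \<le> N"
  shows "(\<Sum>z\<in>Z. output_prob n m A T (\<lambda>r. P r \<and> Q z r)) \<le> N"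
proof -
  define B where "B = query_basis n m (workspace A)"
  let ?\<psi> = "state_after n m A T (queries A)"
  have B: "finite B" using wf by (simp add: wf_query_alg_def B_def query_basis_def)
  have "(\<Sum>z\<in>Z. output_prob n m A T (\<lambda>r. P r \<and> Q z r))
      = (\<Sum>z\<in>Z. \<Sum>x\<in>B. if P (result A x) \<and> Q z (result A x) then (cmod (?\<psi> x))\<^sup>2 else 0)"
    unfolding output_prob_def B_def[symmetric] using B by (simp add: sum.inter_filter)
  also have "\<dots> = (\<Sum>x\<in>B. \<Sum>z\<in>Z. if P (result A x) \<and> Q z (result A x) then (cmod (?\<psi> x))\<^sup>2 else 0)"
    by (rule sum.swap)
  also have "\<dots> \<le> (\<Sum>x\<in>B. N * (cmod (?\<psi> x))\<^sup>2)"
  proof (rule sum_mono)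
    fix x
    show "(\<Sum>z\<in>Z. if P (result A x) \<and> Q z (result A x) then (cmod (?\<psi> x))\<^sup>2 else 0) \<le> N * (cmod (?\<psi> x))\<^sup>2"
      using N(1)[of "result A x"] N(2) Z
      by (cases "P (result A x)") (simp_all add: sum.inter_filter[symmetric] mult_right_mono)
  qed
  also have "\<dots> = N * mass_on B ?\<psi>" by (simp add: mass_on_def sum_distrib_left)
  also have "mass_on B ?\<psi> = 1" unfolding B_def by (rule mass_state_after[OF wf T order_refl])
  finally show ?thesis by simp
qed

text \<open>The adversary relates every \<open>k\<close>-set \<open>x\<close> to all
  \<open>insert z x\<close>. Each left set has \<open>M - k\<close> neighbours and each right set
  \<open>k + 1\<close>, so the bound is the square root of the product, provided structures valid
  for both sides are rare. Assumption \<open>c\<close> ensures this.\<close>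

lemma preprocessing_lower_bound:
  fixes prep :: "('v, 'd) query_alg" and ans :: "nat \<Rightarrow> nat \<Rightarrow> 'd \<Rightarrow> ('w, nat) query_alg"
  assumes scheme: "LCE_scheme (h + M) m \<Sigma> prep ans"
    and cost: "\<And>i j D. i \<in> {1..h + M} \<Longrightarrow> j \<in> {1..h + M} \<Longrightarrow> real (queries (ans i j D)) \<le> c"
    and ab: "a \<in> \<Sigma>" "b \<in> \<Sigma>" "a < 2 ^ m" "b < 2 ^ m" "a \<noteq> b" and M: "M \<le> h" and k: "k < M"
    and c: "3125000 * c\<^sup>2 * real (k + 1) \<le> real (M - k)"
  shows "sqrt (real (M - k) * real (k + 1)) \<le> 100 * real (queries prep)"
proof -
  have wf: "wf_query_alg (h + M) m prep"
    and wf_ans: "\<And>i j D. i \<in> {1..h + M} \<Longrightarrow> j \<in> {1..h + M} \<Longrightarrow> wf_query_alg (h + M) m (ans i j D)"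
    and good: "\<And>T. length T = h + M \<Longrightarrow> set T \<subseteq> \<Sigma> \<Longrightarrow>
        output_prob (h + M) m prep T (valid_structure (h + M) m ans T) \<ge> 2 / 3"
    using scheme by (auto simp: LCE_scheme_def)
  have good_marked: "output_prob (h + M) m prep (marked a b h M x)
      (valid_structure (h + M) m ans (marked a b h M x)) \<ge> 2 / 3" for x
  proof (rule good)
    show "set (marked a b h M x) \<subseteq> \<Sigma>" using set_marked[of a b h M x] ab(1,2) by blast
  qed simp
  let ?E = "marked a b h M" and ?V = "valid_structure (h + M) m ans"
  let ?N = "M choose k"
  define X where "X = {x. x \<subseteq> {..<M} \<and> card x = k}"
  define I where "I = Sigma X (\<lambda>x. {..<M} - x)"
  let ?u = "\<lambda>(x, z). ?E x" and ?v = "\<lambda>(x, z). ?E (insert z x)"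
  let ?pos = "\<lambda>(x :: nat set, z). h + z + 1"
  define R where "R = real (M - k)"
  define K where "K = real (k + 1)"
  \<comment> \<open>There are at most \<open>?N\<close> left strings and \<open>?N * R / K\<close>
    right strings; this weight makes both terms \<open>?N * s\<close>.\<close>
  define s where "s = sqrt (R / K)"
  have RK: "R > 0" "K > 0" using k by (auto simp: R_def K_def)
  have s: "s > 0" "s * s = R / K" using RK by (simp_all add: s_def)
  have N: "?N > 0" using k by simp
  have finX: "finite X" by (simp add: X_def)
  have cardX: "card X = ?N" unfolding X_def using n_subsets[of "{..<M}" k] by simp
  have fin: "finite I" using finX by (simp add: I_def)
  have comp: "card ({..<M} - x) = M - k" if "x \<in> X" for x
    using that by (auto simp: X_def card_Diff_subset finite_subset)
  have cardI: "real (card I) = ?N * R"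
    using comp cardX finX by (simp add: I_def R_def)
  have "card (?u ` I) \<le> card (?E ` X)"
    by (rule card_mono) (use finX in \<open>auto simp: I_def\<close>)
  then have card_u: "card (?u ` I) \<le> ?N" using card_image_le[OF finX, of ?E] cardX by simp
  let ?Y = "{y. y \<subseteq> {..<M} \<and> card y = k + 1}"
  have finY: "finite ?Y" by simp
  have "?v ` I \<subseteq> ?E ` ?Y"
    by (auto simp: I_def X_def finite_subset card_insert_if intro!: imageI)
  then have "card (?v ` I) \<le> card ?Y"
    using finY by (meson card_image_le card_mono finite_imageI order_trans)
  also have "card ?Y = M choose (k + 1)" using n_subsets[of "{..<M}" "k + 1"] by simp
  finally have "real (card (?v ` I)) * K \<le> real (M choose (k + 1)) * K"
    using RK by (intro mult_right_mono) simp_all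
  also have "\<dots> = real ((k + 1) * (M choose (k + 1)))" by (simp only: K_def of_nat_mult mult.commute)
  \<comment> \<open>Both sides count the pairs in \<open>I\<close>, by right and by left
    member.\<close>
  also have "(k + 1) * (M choose (k + 1)) = (M - k) * ?N"
    using binomial_absorption[of k M] binomial_absorb_comp[of M k] by simp
  finally have card_v: "real (card (?v ` I)) \<le> ?N * R / K"
    using RK by (simp add: field_simps R_def)
  have inI: "x \<subseteq> {..<M}" "z < M" "z \<notin> x" if "(x, z) \<in> I" for x z
    using that by (auto simp: I_def X_def)
  have "real (card I) / 25 \<le> real (queries prep) * (s * card (?u ` I) + card (?v ` I) / s)
      + 25 * (\<Sum>p\<in>I. output_prob (h + M) m prep (?u p) (\<lambda>D. ?V (?u p) D \<and> ?V (?v p) D))"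
  proof (rule adversary_bound[OF wf fin s(1), where pos = ?pos])
    show "?pos ` I \<subseteq> {1..h + M}" using inI by fastforce
    show "inj_on (\<lambda>p. (?u p, ?pos p)) I"
    proof (rule inj_onI, clarsimp)
      fix x z y assume xy: "(x, z) \<in> I" "(y, z) \<in> I" "?E x = ?E y"
      then show "x = y" using inI by (intro marked_inject[OF ab(5)])
    qed
    show "inj_on (\<lambda>p. (?v p, ?pos p)) I"
    proof (rule inj_onI, clarsimp)
      fix x z y assume xy: "(x, z) \<in> I" "(y, z) \<in> I" "?E (insert z x) = ?E (insert z y)"
      then have "insert z x = insert z y"
        using inI by (intro marked_inject[OF ab(5)]) auto
      \<comment> \<open>The position fixes \<open>z\<close>, and removing \<open>z\<close> from the
        union recovers \<open>x\<close> since \<open>z\<close> is outside \<open>x\<close>.\<close>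
      then show "x = y" using inI(3)[OF xy(1)] inI(3)[OF xy(2)] by auto
    qed
    show "2 / 3 \<le> output_prob (h + M) m prep (?u p) (?V (?u p))" for p
      unfolding split_def by (rule good_marked)
    show "2 / 3 \<le> output_prob (h + M) m prep (?v p) (?V (?v p))" for p
      unfolding split_def by (rule good_marked)
    show "?u p ! (j - 1) = ?v p ! (j - 1)" if "j \<in> {1..h + M}" "j \<noteq> ?pos p" for p j
      using that unfolding split_def by (intro marked_agree)
  qed (use ab marked_less in \<open>auto split: prod.split simp del: One_nat_def\<close>)
  also have "(\<Sum>p\<in>I. output_prob (h + M) m prep (?u p) (\<lambda>D. ?V (?u p) D \<and> ?V (?v p) D))
      = (\<Sum>x\<in>X. \<Sum>z\<in>{..<M} - x. output_prob (h + M) m prep (?E x) (\<lambda>D. ?V (?E x) D \<and> ?V (?E (insert z x)) D))"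
    using finX by (simp add: I_def sum.Sigma split_def)
  also have "\<dots> \<le> (\<Sum>x\<in>X. K * (2500 * c\<^sup>2))"
  proof (rule sum_mono, rule sum_output_prob_le[OF wf])
    fix x D assume x: "x \<in> X" and D: "?V (?E x) D"
    show "real (card {z \<in> {..<M} - x. ?V (?E (insert z x)) D}) \<le> K * (2500 * c\<^sup>2)"
      using card_valid_insert_le[OF wf_ans cost ab(3-5) M _ D] x by (simp add: X_def K_def)
  qed (use ab marked_less RK in auto)
  also have "\<dots> = ?N * (2500 * c\<^sup>2 * K)" by (simp add: cardX)
  also have "real (queries prep) * (s * card (?u ` I) + card (?v ` I) / s)
      \<le> real (queries prep) * (s * ?N + ?N * R / K / s)"
    using s(1) card_u card_v by (intro mult_left_mono add_mono divide_right_mono) auto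
  also have "?N * R / K / s = ?N * s" using s RK by (simp add: field_simps)
  finally have "?N * (R / 25) \<le> ?N * (2 * queries prep * s + 62500 * c\<^sup>2 * K)"
    by (simp add: cardI algebra_simps)
  then have "R / 25 \<le> 2 * queries prep * s + 62500 * c\<^sup>2 * K"
    using N by simp
  \<comment> \<open>As \<open>3125000 = 50 * 62500\<close>, the shared-structure term is at most
    \<open>R / 50\<close>, half of the left side \<open>R / 25\<close>.\<close>
  moreover have "3125000 * c\<^sup>2 * K \<le> R" using c by (simp only: K_def R_def)
  ultimately have "R \<le> 100 * queries prep * s" by simp
  moreover have "R = s * sqrt (R * K)"
    using RK by (simp add: s_def real_sqrt_mult real_sqrt_divide)
  ultimately have "s * sqrt (R * K) \<le> s * (100 * queries prep)" by (simp add: mult_ac)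
  then show ?thesis using s(1) by (simp add: R_def K_def)
qed

section \<open>Choice of the parameters\<close>

lemma tradeoff:
  fixes prep :: "('v, 'd) query_alg" and ans :: "nat \<Rightarrow> nat \<Rightarrow> 'd \<Rightarrow> ('w, nat) query_alg"
  assumes n: "n \<ge> 2" and alphabet: "\<Sigma> \<subseteq> {..<2 ^ m}" "card \<Sigma> \<ge> 2"
    and scheme: "LCE_scheme n m \<Sigma> prep ans"
    and prep_cost: "real (queries prep) \<le> p"
    and ans_cost: "\<And>i j D. i \<in> {1..n} \<Longrightarrow> j \<in> {1..n} \<Longrightarrow> real (queries (ans i j D)) \<le> q"
  shows "real n / 1500000 \<le> (p + sqrt n) * (q + 1)"
proof -
  define M where "M = n div 2"
  define h where "h = n - M"
  \<comment> \<open>The shift keeps the divisor in \<open>y\<close> positive even when answering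
    takes no queries, and matches the factor in the goal.\<close>
  define c where "c = q + 1"
  have "n \<le> 3 * M" using n unfolding M_def by linarith
  then have M: "real n \<le> 3 * real M" by linarith
  have hM: "n = h + M" "M \<le> h" "M \<ge> 1"
    using n by (auto simp: h_def M_def)
  have p: "p \<ge> 0" using prep_cost of_nat_0_le_iff order_trans by blast
  have "0 \<le> real (queries (ans 1 1 undefined))" by simp
  also have "\<dots> \<le> q" using n by (intro ans_cost) auto
  finally have c: "c \<ge> 1" by (simp add: c_def)
  \<comment> \<open>The real-valued target for \<open>k + 1\<close>. Its constant is twice
    \<open>3125000\<close>, because only \<open>M / 2\<close> is guaranteed for
    \<open>M - k\<close>; it also equals \<open>2500 * 2500\<close>.\<close>
  define y where "y = real M / (6250000 * c\<^sup>2)"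
  have c2: "c\<^sup>2 \<ge> 1" using c by (simp add: one_le_power)
  show ?thesis
  proof (cases "y \<ge> 1")
    case False
    moreover have "6250000 * c\<^sup>2 > 0" using c2 by linarith
    ultimately have "real M < 6250000 * c\<^sup>2" by (simp add: y_def pos_le_divide_eq)
    then have "real M < (2500 * c)\<^sup>2" by (simp add: power_mult_distrib)
    then have "real n \<le> (5000 * c)\<^sup>2" using M by (simp add: power_mult_distrib)
    then have "sqrt n \<le> 5000 * c" using c by (simp add: real_le_lsqrt)
    then have "sqrt n * sqrt n \<le> sqrt n * (5000 * c)" by (intro mult_left_mono) auto
    then have "real n \<le> 5000 * (sqrt n * c)" by simp
    moreover have "0 \<le> p * c" using p c by simp
    ultimately show ?thesis by (simp add: c_def distrib_right)
  next
    case True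
    \<comment> \<open>Then \<open>k + 1\<close> is the floor of \<open>y\<close>, which lies between
      \<open>y / 2\<close> and \<open>y\<close> because \<open>y \<ge> 1\<close>.\<close>
    define k where "k = nat \<lfloor>y\<rfloor> - 1"
    have fl: "\<lfloor>y\<rfloor> \<ge> 1" using True by simp
    then have k: "real (k + 1) = of_int \<lfloor>y\<rfloor>" by (simp add: k_def of_nat_diff nat_diff_distrib)
    have ky: "real (k + 1) \<le> y" "y / 2 \<le> real (k + 1)" unfolding k using fl by linarith+
    have "y \<le> real M / 2" unfolding y_def using c2 by (intro divide_left_mono) auto
    then have kM: "k < M" "real M / 2 \<le> real (M - k)" using ky(1) hM(3) by (auto simp: of_nat_diff)
    have "finite \<Sigma>" using alphabet(1) finite_subset by blast
    then obtain a b where ab: "a \<in> \<Sigma>" "b \<in> \<Sigma>" "a \<noteq> b"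
      using alphabet(2) by (auto simp: numeral_2_eq_2 card_le_Suc0_iff_eq not_le[symmetric] Suc_le_eq)
    have "3125000 * c\<^sup>2 * real (k + 1) \<le> 3125000 * c\<^sup>2 * y"
      using ky(1) by (intro mult_left_mono) auto
    also have "\<dots> = real M / 2" using c by (simp add: y_def)
    finally have "3125000 * c\<^sup>2 * real (k + 1) \<le> real (M - k)" using kM by simp
    moreover have "real (queries (ans i j D)) \<le> c" if "i \<in> {1..h + M}" "j \<in> {1..h + M}" for i j D
      using ans_cost[of i j D] that hM(1) by (simp add: c_def)
    ultimately have lower: "sqrt (real (M - k) * real (k + 1)) \<le> 100 * real (queries prep)"
      using scheme ab alphabet(1) hM kM(1) by (intro preprocessing_lower_bound[of h M m \<Sigma> prep ans c a b]) auto
    have "(real M / (5000 * c))\<^sup>2 = (real M / 2) * (y / 2)"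
      using c by (simp add: y_def power2_eq_square field_simps)
    also have "\<dots> \<le> real (M - k) * real (k + 1)"
      using kM ky True by (intro mult_mono) auto
    finally have "real M / (5000 * c) \<le> sqrt (real (M - k) * real (k + 1))"
      by (rule real_le_rsqrt)
    \<comment> \<open>With \<open>n \<le> 3 * M\<close> this gives the constant
      \<open>3 * 5000 * 100 = 1500000\<close>.\<close>
    then have "real M / (5000 * c) \<le> 100 * p" using lower prep_cost by linarith
    then have "real M \<le> 500000 * (p * c)" using c by (simp add: field_simps)
    moreover have "0 \<le> sqrt n * c" using c by simp
    ultimately show ?thesis using M by (simp add: c_def distrib_right)
  qed
qed

text \<open>\<open>T_prep\<close> and \<open>T_ans\<close> may be any upper bounds on the query
  counts, so every cost measure that charges at least 1 per query is covered.\<close>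

theorem theorem1p5:
  fixes \<Sigma> :: "nat \<Rightarrow> nat set" and m :: "nat \<Rightarrow> nat"
    and prep :: "nat \<Rightarrow> ('v, 'd) query_alg"
    and ans :: "nat \<Rightarrow> nat \<Rightarrow> nat \<Rightarrow> 'd \<Rightarrow> ('w, nat) query_alg"
    and T_prep T_ans :: "nat \<Rightarrow> real"
  assumes alphabet: "\<And>n. n \<ge> 1 \<Longrightarrow> \<Sigma> n \<subseteq> {..<2 ^ m n} \<and> card (\<Sigma> n) \<ge> 2"
    and scheme: "\<And>n. n \<ge> 1 \<Longrightarrow> LCE_scheme n (m n) (\<Sigma> n) (prep n) (ans n)"
    and prep_cost: "\<And>n. n \<ge> 1 \<Longrightarrow> real (queries (prep n)) \<le> T_prep n"
    and ans_cost: "\<And>n i j D. n \<ge> 1 \<Longrightarrow> i \<in> {1..n} \<Longrightarrow> j \<in> {1..n} \<Longrightarrow>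
                     real (queries (ans n i j D)) \<le> T_ans n"
  shows "(\<lambda>n. (T_prep n + sqrt (real n)) * (T_ans n + 1)) \<in> soft_Omega (\<lambda>n. real n)"
proof -
  have "real n \<le> 1500000 * ((T_prep n + sqrt (real n)) * (T_ans n + 1))" if "n \<ge> 2" for n
    using tradeoff[OF that, of "\<Sigma> n" "m n" "prep n" "ans n" "T_prep n" "T_ans n"]
      alphabet[of n] scheme[of n] prep_cost[of n] ans_cost[of n] that by simp
  then have "\<forall>\<^sub>F n in at_top. norm (real n) \<le> 1500000 * norm ((T_prep n + sqrt (real n)) * (T_ans n + 1))"
    unfolding eventually_at_top_linorder by (intro exI[of _ 2] allI impI) fastforce
  then have "(\<lambda>n. real n) \<in> O(\<lambda>n. (T_prep n + sqrt (real n)) * (T_ans n + 1))"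
    by (rule bigoI)
  \<comment> \<open>The constant is uniform in \<open>n\<close>, so the logarithm gets exponent
    0.\<close>
  then have "(\<lambda>n. (T_prep n + sqrt (real n)) * (T_ans n + 1)) \<in> \<Omega>(\<lambda>n. real n / ln (real n) ^ 0)"
    by (simp add: bigomega_iff_bigo)
  then show ?thesis unfolding soft_Omega_def by blast
qed

end
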